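(* Let $S$ be a finite ai-semiring with multiplicative identity $1$. If $1$ is either the greatest or the least element of the additive order of $S$, then $S$ is not inherently nonfinitely based. Consequently, if $S$ is inherently nonfinitely based, then there exist $a,b\in S$ such that $a\nleq 1$ and $1\nleq b$.
   Context: An ai-semiring is an algebra $(S,+,\cdot)$ with two binary operations and no designated constants, such that $(S,+)$ is a commutative idempotent semigroup, $(S,\cdot)$ is a semigroup, and $\cdot$ distributes over $+$ on both sides. Its additive order is $a\le b\iff a+b=b$. Varieties are in the signature $\{+,\cdot\}$. A variety is locally finite if all finitely generated members are finite, and finitely based if it is axiomatized by finitely many identities. A locally finite variety is inherently nonfinitely based if it is contained in no finitely based locally finite variety of the same signature; an algebra is inherently nonfinitely based if the variety it generates is. *)

theory Defs
  imports "HOL-Library.Countable_Set"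
begin

section \<open>Algebras with two binary operations\<close>

text \<open>The operations are total functions on the underlying type; only their values on the carrier
  matter.  Algebras are nonempty.\<close>

record 'a alg =
  carr :: "'a set"
  add :: "'a \<Rightarrow> 'a \<Rightarrow> 'a"  (infixl "\<oplus>\<index>" 65)
  mul :: "'a \<Rightarrow> 'a \<Rightarrow> 'a"  (infixl "\<odot>\<index>" 70)

definition algebra :: "'a alg \<Rightarrow> bool" where
  "algebra A \<longleftrightarrow> carr A \<noteq> {} \<and>
    (\<forall>x\<in>carr A. \<forall>y\<in>carr A. x \<oplus>\<^bsub>A\<^esub> y \<in> carr A \<and> x \<odot>\<^bsub>A\<^esub> y \<in> carr A)"

definition ai_semiring :: "'a alg \<Rightarrow> bool" where
  "ai_semiring S \<longleftrightarrow> algebra S \<and>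
    (\<forall>x\<in>carr S. \<forall>y\<in>carr S. \<forall>z\<in>carr S. (x \<oplus>\<^bsub>S\<^esub> y) \<oplus>\<^bsub>S\<^esub> z = x \<oplus>\<^bsub>S\<^esub> (y \<oplus>\<^bsub>S\<^esub> z)) \<and>
    (\<forall>x\<in>carr S. \<forall>y\<in>carr S. x \<oplus>\<^bsub>S\<^esub> y = y \<oplus>\<^bsub>S\<^esub> x) \<and>
    (\<forall>x\<in>carr S. x \<oplus>\<^bsub>S\<^esub> x = x) \<and>
    (\<forall>x\<in>carr S. \<forall>y\<in>carr S. \<forall>z\<in>carr S. (x \<odot>\<^bsub>S\<^esub> y) \<odot>\<^bsub>S\<^esub> z = x \<odot>\<^bsub>S\<^esub> (y \<odot>\<^bsub>S\<^esub> z)) \<and>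
    (\<forall>x\<in>carr S. \<forall>y\<in>carr S. \<forall>z\<in>carr S.
        x \<odot>\<^bsub>S\<^esub> (y \<oplus>\<^bsub>S\<^esub> z) = (x \<odot>\<^bsub>S\<^esub> y) \<oplus>\<^bsub>S\<^esub> (x \<odot>\<^bsub>S\<^esub> z)) \<and>
    (\<forall>x\<in>carr S. \<forall>y\<in>carr S. \<forall>z\<in>carr S.
        (x \<oplus>\<^bsub>S\<^esub> y) \<odot>\<^bsub>S\<^esub> z = (x \<odot>\<^bsub>S\<^esub> z) \<oplus>\<^bsub>S\<^esub> (y \<odot>\<^bsub>S\<^esub> z))"

definition ai_le :: "'a alg \<Rightarrow> 'a \<Rightarrow> 'a \<Rightarrow> bool"  (infix "\<sqsubseteq>\<index>" 50) where
  "a \<sqsubseteq>\<^bsub>S\<^esub> b \<longleftrightarrow> a \<oplus>\<^bsub>S\<^esub> b = b"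

definition mult_identity :: "'a alg \<Rightarrow> 'a \<Rightarrow> bool" where
  "mult_identity S e \<longleftrightarrow> e \<in> carr S \<and> (\<forall>x\<in>carr S. e \<odot>\<^bsub>S\<^esub> x = x \<and> x \<odot>\<^bsub>S\<^esub> e = x)"

inductive_set generated :: "'a alg \<Rightarrow> 'a set \<Rightarrow> 'a set" for A X where
  base: "x \<in> X \<Longrightarrow> x \<in> generated A X"
| add: "x \<in> generated A X \<Longrightarrow> y \<in> generated A X \<Longrightarrow> x \<oplus>\<^bsub>A\<^esub> y \<in> generated A X"
| mul: "x \<in> generated A X \<Longrightarrow> y \<in> generated A X \<Longrightarrow> x \<odot>\<^bsub>A\<^esub> y \<in> generated A X"

definition finitely_generated :: "'a alg \<Rightarrow> bool" where
  "finitely_generated A \<longleftrightarrow> (\<exists>X. finite X \<and> X \<subseteq> carr A \<and> generated A X = carr A)"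


section \<open>Identities and varieties\<close>

datatype trm = Var nat | Plus trm trm | Times trm trm

type_synonym ident = "trm \<times> trm"

primrec eval :: "'a alg \<Rightarrow> (nat \<Rightarrow> 'a) \<Rightarrow> trm \<Rightarrow> 'a" where
  "eval A v (Var n) = v n"
| "eval A v (Plus s t) = eval A v s \<oplus>\<^bsub>A\<^esub> eval A v t"
| "eval A v (Times s t) = eval A v s \<odot>\<^bsub>A\<^esub> eval A v t"

definition satisfies :: "'a alg \<Rightarrow> ident \<Rightarrow> bool" where
  "satisfies A p \<longleftrightarrow> (\<forall>v. range v \<subseteq> carr A \<longrightarrow> eval A v (fst p) = eval A v (snd p))"

definition Mod :: "ident set \<Rightarrow> 'a alg set" where
  "Mod E = {A. algebra A \<and> (\<forall>p\<in>E. satisfies A p)}"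

definition Id_of :: "'a alg \<Rightarrow> ident set" where
  "Id_of A = {p. satisfies A p}"

text \<open>A variety is an equational class, represented by its members with carrier contained in
  \<^typ>\<open>nat\<close>.  Nothing is lost: every finitely generated algebra is countable, hence isomorphic to one
  of these, and identities involve only finitely many variables, so inclusion of varieties is decided
  on countable members.  The lemmas \<open>locally_finite_Mod_iff\<close> and \<open>Mod_subset_transfer\<close> below verify
  this against algebras on arbitrary types.\<close>

type_synonym algclass = "nat alg set"

definition variety :: "algclass \<Rightarrow> bool" where
  "variety V \<longleftrightarrow> (\<exists>E. V = Mod E)"

definition finitely_based :: "algclass \<Rightarrow> bool" where
  "finitely_based V \<longleftrightarrow> (\<exists>E. finite E \<and> V = Mod E)"

definition locally_finite :: "algclass \<Rightarrow> bool" where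
  "locally_finite V \<longleftrightarrow> (\<forall>A\<in>V. finitely_generated A \<longrightarrow> finite (carr A))"

definition inherently_nonfinitely_based :: "algclass \<Rightarrow> bool" where
  "inherently_nonfinitely_based V \<longleftrightarrow> variety V \<and> locally_finite V \<and>
    \<not> (\<exists>W. variety W \<and> locally_finite W \<and> finitely_based W \<and> V \<subseteq> W)"

text \<open>The smallest equational class containing an algebra is defined by all identities of that
  algebra, see \<open>variety_generated_least\<close>.\<close>

definition variety_generated :: "'a alg \<Rightarrow> algclass" where
  "variety_generated A = Mod (Id_of A)"

definition INFB :: "'a alg \<Rightarrow> bool" where
  "INFB A \<longleftrightarrow> inherently_nonfinitely_based (variety_generated A)"


section \<open>Independence of the underlying type\<close>

lemma variety_generated_least:
  assumes "algebra A"
  shows "variety (variety_generated A)" and "A \<in> Mod (Id_of A)"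
    and "A \<in> Mod E \<Longrightarrow> variety_generated A \<subseteq> Mod E"
proof -
  show "variety (variety_generated A)"
    unfolding variety_def variety_generated_def by (rule exI, rule refl)
qed (use assms in \<open>auto simp: variety_generated_def Mod_def Id_of_def\<close>)

definition subalg :: "'a alg \<Rightarrow> 'a set \<Rightarrow> 'a alg" where
  "subalg A X = A\<lparr>carr := generated A X\<rparr>"

definition transport :: "('a \<Rightarrow> 'b) \<Rightarrow> 'a alg \<Rightarrow> 'b alg" where
  "transport f A = (let g = inv_into (carr A) f in
     \<lparr>carr = f ` carr A, add = (\<lambda>x y. f (g x \<oplus>\<^bsub>A\<^esub> g y)), mul = (\<lambda>x y. f (g x \<odot>\<^bsub>A\<^esub> g y))\<rparr>)"

instance trm :: countable
  by countable_datatype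

lemma eval_closed: "algebra A \<Longrightarrow> range v \<subseteq> carr A \<Longrightarrow> eval A v t \<in> carr A"
  by (induction t) (auto simp: algebra_def)

lemma generated_subset: "algebra A \<Longrightarrow> X \<subseteq> carr A \<Longrightarrow> generated A X \<subseteq> carr A"
proof
  fix x assume a: "algebra A" "X \<subseteq> carr A" "x \<in> generated A X"
  from a(3) show "x \<in> carr A"
    by induction (use a(1,2) in \<open>auto simp: algebra_def\<close>)
qed

lemma generated_countable:
  assumes "countable X" shows "countable (generated A X)"
proof (cases "X = {}")
  case True
  have "x \<in> generated A X \<Longrightarrow> False" for x
    by (induction rule: generated.induct) (auto simp: True)
  then have "generated A X = {}" by blast
  then show ?thesis by simp
next
  case False
  have "x \<in> range (eval A (from_nat_into X))" if "x \<in> generated A X" for x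
    using that
  proof induction
    case (base x)
    then have "eval A (from_nat_into X) (Var (to_nat_on X x)) = x"
      using assms by simp
    then show ?case by (rule range_eqI[OF sym])
  next
    case (add x y)
    then obtain s t where "x = eval A (from_nat_into X) s" "y = eval A (from_nat_into X) t"
      by auto
    then have "x \<oplus>\<^bsub>A\<^esub> y = eval A (from_nat_into X) (Plus s t)" by simp
    then show ?case by (rule range_eqI)
  next
    case (mul x y)
    then obtain s t where "x = eval A (from_nat_into X) s" "y = eval A (from_nat_into X) t"
      by auto
    then have "x \<odot>\<^bsub>A\<^esub> y = eval A (from_nat_into X) (Times s t)" by simp
    then show ?case by (rule range_eqI)
  qed
  then have "generated A X \<subseteq> range (eval A (from_nat_into X))" by blast
  then show ?thesis
    by (rule countable_subset) simp
qed

lemma eval_subalg [simp]: "eval (subalg A X) v t = eval A v t"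
  by (induction t) (auto simp: subalg_def)

lemma carr_subalg [simp]: "carr (subalg A X) = generated A X"
  by (simp add: subalg_def)

lemma subalg_Mod:
  assumes "A \<in> Mod E" "X \<subseteq> carr A" "X \<noteq> {}"
  shows "subalg A X \<in> Mod E"
proof -
  have sub: "generated A X \<subseteq> carr A"
    using assms generated_subset by (auto simp: Mod_def)
  have "generated A X \<noteq> {}"
    using assms(3) generated.base by fastforce
  moreover have "add (subalg A X) = add A" "mul (subalg A X) = mul A"
    by (simp_all add: subalg_def)
  ultimately have "algebra (subalg A X)"
    by (simp add: algebra_def generated.add generated.mul)
  moreover have "satisfies (subalg A X) p" if "p \<in> E" for p
    using assms(1) sub that unfolding Mod_def satisfies_def by fastforce
  ultimately show ?thesis
    by (simp add: Mod_def)
qed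

lemma eval_transport:
  assumes "algebra A" "inj_on f (carr A)" "range v \<subseteq> carr A"
  shows "eval (transport f A) (f \<circ> v) t = f (eval A v t)"
  by (induction t)
    (use assms eval_closed[OF assms(1,3)] in \<open>auto simp: transport_def Let_def\<close>)

lemma carr_transport [simp]: "carr (transport f A) = f ` carr A"
  by (simp add: transport_def Let_def)

lemma algebra_transport:
  assumes "algebra A" "inj_on f (carr A)" shows "algebra (transport f A)"
  using assms by (auto simp: algebra_def transport_def Let_def)

lemma satisfies_transport_iff:
  assumes "algebra A" "inj_on f (carr A)"
  shows "satisfies (transport f A) p \<longleftrightarrow> satisfies A p"
proof
  assume s: "satisfies (transport f A) p"
  show "satisfies A p"
    unfolding satisfies_def
  proof (intro allI impI)
    fix v :: "nat \<Rightarrow> 'a" assume v: "range v \<subseteq> carr A"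
    then have "range (f \<circ> v) \<subseteq> carr (transport f A)" by auto
    then have "f (eval A v (fst p)) = f (eval A v (snd p))"
      using s eval_transport[OF assms v] unfolding satisfies_def by metis
    then show "eval A v (fst p) = eval A v (snd p)"
      using assms(2) eval_closed[OF assms(1) v] by (meson inj_onD)
  qed
next
  assume s: "satisfies A p"
  show "satisfies (transport f A) p"
    unfolding satisfies_def
  proof (intro allI impI)
    fix w :: "nat \<Rightarrow> 'b" assume w: "range w \<subseteq> carr (transport f A)"
    define v where "v = inv_into (carr A) f \<circ> w"
    have v: "range v \<subseteq> carr A"
      using w by (auto simp: v_def intro!: inv_into_into)
    have "w n \<in> f ` carr A" for n
      using w by auto
    then have "f \<circ> v = w"
      by (simp add: v_def fun_eq_iff f_inv_into_f)
    then show "eval (transport f A) w (fst p) = eval (transport f A) w (snd p)"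
      using eval_transport[OF assms v] s v unfolding satisfies_def by metis
  qed
qed

lemma transport_Mod_iff:
  assumes "algebra A" "inj_on f (carr A)"
  shows "transport f A \<in> Mod E \<longleftrightarrow> A \<in> Mod E"
  using assms algebra_transport satisfies_transport_iff by (fastforce simp: Mod_def)

lemma finitely_generated_transport:
  assumes "algebra A" "inj_on f (carr A)" "finitely_generated A"
  shows "finitely_generated (transport f A)"
proof -
  obtain X where X: "finite X" "X \<subseteq> carr A" "generated A X = carr A"
    using assms(3) by (auto simp: finitely_generated_def)
  have "f x \<in> generated (transport f A) (f ` X)" if "x \<in> generated A X" for x
    using that
  proof induction
    case (base x)
    then show ?case by (auto intro: generated.base)
  next
    case (add x y)
    then have "f x \<oplus>\<^bsub>transport f A\<^esub> f y = f (x \<oplus>\<^bsub>A\<^esub> y)"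
      using assms(2) X(3) by (simp add: transport_def Let_def)
    then show ?case using generated.add[OF add.IH] by simp
  next
    case (mul x y)
    then have "f x \<odot>\<^bsub>transport f A\<^esub> f y = f (x \<odot>\<^bsub>A\<^esub> y)"
      using assms(2) X(3) by (simp add: transport_def Let_def)
    then show ?case using generated.mul[OF mul.IH] by simp
  qed
  then have "f ` carr A \<subseteq> generated (transport f A) (f ` X)"
    using X(3) by auto
  moreover have "generated (transport f A) (f ` X) \<subseteq> f ` carr A"
    using generated_subset[OF algebra_transport[OF assms(1,2)], of "f ` X"] image_mono[OF X(2), of f]
    by simp
  ultimately show ?thesis
    unfolding finitely_generated_def using X(1,2)
    by (intro exI[of _ "f ` X"]) auto
qed

lemma locally_finite_transfer:
  fixes A :: "'a alg"
  assumes "locally_finite (Mod E)" "A \<in> Mod E" "finitely_generated A"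
  shows "finite (carr A)"
proof -
  have A: "algebra A" using assms(2) by (simp add: Mod_def)
  obtain X where X: "finite X" "generated A X = carr A"
    using assms(3) by (auto simp: finitely_generated_def)
  have "countable (carr A)"
    using generated_countable[OF countable_finite[OF X(1)], of A] X(2) by simp
  then obtain f :: "'a \<Rightarrow> nat" where f: "inj_on f (carr A)"
    unfolding countable_def by blast
  have "finite (carr (transport f A))"
    using assms transport_Mod_iff[OF A f] finitely_generated_transport[OF A f]
    unfolding locally_finite_def by blast
  then show ?thesis using f by (simp add: finite_image_iff)
qed

lemma locally_finite_Mod_iff:
  assumes "infinite (UNIV :: 'a set)"
  shows "locally_finite (Mod E) \<longleftrightarrow>
    (\<forall>A :: 'a alg. A \<in> Mod E \<longrightarrow> finitely_generated A \<longrightarrow> finite (carr A))"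
proof
  assume r: "\<forall>A :: 'a alg. A \<in> Mod E \<longrightarrow> finitely_generated A \<longrightarrow> finite (carr A)"
  obtain f :: "nat \<Rightarrow> 'a" where f: "inj f"
    using assms infinite_countable_subset by blast
  show "locally_finite (Mod E)"
    unfolding locally_finite_def
  proof (intro ballI impI)
    fix A :: "nat alg" assume A: "A \<in> Mod E" "finitely_generated A"
    have i: "inj_on f (carr A)" using f by (auto intro: inj_on_subset)
    have "finite (carr (transport f A))"
      using A r i transport_Mod_iff[of A f E] finitely_generated_transport[of A f]
      unfolding Mod_def by blast
    then show "finite (carr A)" using i by (simp add: finite_image_iff)
  qed
qed (use locally_finite_transfer in blast)

lemma Mod_subset_transfer:
  assumes "(Mod E :: nat alg set) \<subseteq> Mod F"
  shows "(Mod E :: 'a alg set) \<subseteq> Mod F"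
proof
  fix A :: "'a alg" assume A: "A \<in> Mod E"
  have "satisfies A p" if p: "p \<in> F" for p
    unfolding satisfies_def
  proof (intro allI impI)
    fix v :: "nat \<Rightarrow> 'a" assume v: "range v \<subseteq> carr A"
    define B where "B = subalg A (range v)"
    have B: "B \<in> Mod E" "algebra B"
      using subalg_Mod[OF A v] by (auto simp: B_def Mod_def)
    have "countable (carr B)" by (simp add: B_def generated_countable)
    then obtain f :: "'a \<Rightarrow> nat" where f: "inj_on f (carr B)"
      unfolding countable_def by blast
    have "B \<in> Mod F"
      using B f assms transport_Mod_iff by blast
    moreover have "range v \<subseteq> carr B" by (auto simp: B_def intro: generated.base)
    ultimately show "eval A v (fst p) = eval A v (snd p)"
      using p unfolding Mod_def satisfies_def B_def by auto
  qed
  then show "A \<in> Mod F" using A by (simp add: Mod_def)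
qed

end

theory Submission
  imports Defs
begin

text \<open>
  If the identity is extremal, multiplying moves every element in one direction of the order, so
  \<open>y b c = y\<close> forces \<open>y b = y\<close>, and dually on the left.  Let \<open>Z\<^sub>0\<close> be empty and
  \<open>Z\<^sub>i\<^sub>+\<^sub>1 = Z\<^sub>i x\<^sub>i Z\<^sub>i\<close> be the Zimin words.  Among more than \<open>|S|\<close> of their values two coincide, and
  then some value \<open>z\<close> of \<open>Z\<^sub>i\<close> is an idempotent that absorbs \<open>x\<^sub>i\<close> and every suffix of \<open>Z\<^sub>i\<close>.
  Consequently \<open>S\<close> satisfies the length-reducing identity \<open>Z\<^sub>m = x\<^sub>0\<^sup>-\<^sup>1 Z\<^sub>m\<close> for \<open>m = |S| + 1\<close>.
  Zimin words are unavoidable, so this identity and the ai-semiring axioms define a locally finite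
  variety.
\<close>

section \<open>Zimin words\<close>

primrec zimin :: "nat \<Rightarrow> nat list" where
  "zimin 0 = []"
| "zimin (Suc m) = zimin m @ m # zimin m"

lemma set_zimin: "set (zimin m) = {..<m}"
  by (induction m) (simp_all add: lessThan_Suc)

lemma zimin_prefix: "i \<le> m \<Longrightarrow> \<exists>s. zimin m = zimin i @ s"
  by (induction m rule: dec_induct) auto

lemma length_zimin_ge: "m \<le> length (zimin m)"
  by (induction m) auto

text \<open>Pigeonhole: blocks of length \<open>N\<close> start at the multiples of
  \<open>N + 1\<close>, and there is one block more than there are words of length \<open>N\<close>
  over \<open>X\<close>. The stride leaves a letter between neighbouring blocks, so \<open>r\<close>
  is nonempty even for adjacent ones.\<close>

lemma equal_blocks:
  assumes "finite X" and "w \<in> lists X" and len: "(N + 1) * (card X ^ N + 1) \<le> length w"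
  obtains p u r q where "w = p @ u @ r @ u @ q" and "length u = N" and "r \<noteq> []"
proof -
  define blk where "blk i = take N (drop (i * (N + 1)) w)" for i
  define K where "K = card X ^ N"
  have le: "i * (N + 1) + N \<le> length w" if "i \<le> K" for i
  proof -
    have "i * (N + 1) \<le> K * (N + 1)"
      using that by (rule mult_le_mono1)
    then show ?thesis
      using len by (simp add: K_def algebra_simps)
  qed
  have "blk ` {..K} \<subseteq> {u. set u \<subseteq> X \<and> length u = N}"
    using assms(2) le by (fastforce simp: blk_def dest: in_set_takeD in_set_dropD)
  then have "card (blk ` {..K}) \<le> K"
    using card_mono[OF finite_lists_length_eq[OF assms(1)]] card_lists_length_eq[OF assms(1)]
    unfolding K_def by metis
  then have "\<not> inj_on blk {..K}"
    by (intro pigeonhole) simp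
  then obtain i j where ij: "i < j" "j \<le> K" "blk i = blk j"
    by (auto simp: inj_on_def) (metis linorder_neqE_nat)
  \<comment> \<open>\<open>Suc d\<close> is the length of the gap between the two equal
    blocks.\<close>
  obtain d where d: "j * (N + 1) = i * (N + 1) + N + Suc d"
  proof -
    have "Suc i * (N + 1) \<le> j * (N + 1)"
      using ij(1) by (intro mult_right_mono) auto
    then show ?thesis
      using that[of "j * (N + 1) - (i * (N + 1) + N + 1)"] by simp
  qed
  define w1 where "w1 = drop (i * (N + 1)) w"
  define w2 where "w2 = drop N w1"
  define w3 where "w3 = drop (Suc d) w2"
  have w3: "w3 = drop (j * (N + 1)) w"
    unfolding w3_def w2_def w1_def drop_drop d by (simp add: algebra_simps)
  have len2: "length w2 \<ge> Suc d"
    using le[OF ij(2)] unfolding w2_def w1_def d by simp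
  have "w = take (i * (N + 1)) w @ w1" "w1 = blk i @ w2"
    by (simp_all only: w1_def w2_def blk_def append_take_drop_id)
  moreover have "w2 = take (Suc d) w2 @ w3"
    by (simp only: w3_def append_take_drop_id)
  moreover have "w3 = blk j @ drop N w3"
    by (simp only: w3 blk_def append_take_drop_id)
  ultimately have "w = take (i * (N + 1)) w @ blk i @ take (Suc d) w2 @ blk i @ drop N w3"
    using ij(3) by metis
  moreover have "length (blk i) = N"
    using le[of i] ij(1,2) by (simp add: blk_def)
  moreover have "take (Suc d) w2 \<noteq> []"
    using len2 by (cases w2) auto
  ultimately show ?thesis
    using that by blast
qed

text \<open>Two equal disjoint blocks, each long enough for \<open>zimin m\<close>, contain the same
  image of it at the same place. What lies between the two copies becomes the image of the new
  letter \<open>m\<close>.\<close>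

lemma zimin_unavoidable:
  assumes "finite X"
  shows "\<exists>N. \<forall>w\<in>lists X. N \<le> length w \<longrightarrow>
    (\<exists>\<phi> p q. (\<forall>n. \<phi> n \<in> lists X - {[]}) \<and> w = p @ concat (map \<phi> (zimin m)) @ q)"
proof (induction m)
  case 0
  \<comment> \<open>The image of \<open>zimin 0\<close> is empty, but the values of
    \<open>\<phi>\<close> must be nonempty words over \<open>X\<close>. With the bound 1,
    \<open>w\<close> itself is one.\<close>
  have "\<exists>\<phi> p q. (\<forall>n::nat. \<phi> n \<in> lists X - {[]}) \<and> w = p @ concat (map \<phi> (zimin 0)) @ q"
    if "w \<in> lists X" "1 \<le> length w" for w
    using that by (intro exI[of _ "\<lambda>_. w"] exI[of _ w] exI[of _ "[]"]) auto
  then show ?case by blast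
next
  case (Suc m)
  then obtain N where N: "\<And>w. w \<in> lists X \<Longrightarrow> N \<le> length w \<Longrightarrow>
      \<exists>\<phi> p q. (\<forall>n. \<phi> n \<in> lists X - {[]}) \<and> w = p @ concat (map \<phi> (zimin m)) @ q"
    by blast
  have "\<exists>\<phi> p q. (\<forall>n. \<phi> n \<in> lists X - {[]}) \<and> w = p @ concat (map \<phi> (zimin (Suc m))) @ q"
    if w: "w \<in> lists X" "(N + 1) * (card X ^ N + 1) \<le> length w" for w
  proof -
    obtain p u r q where eq: "w = p @ u @ r @ u @ q" "length u = N" "r \<noteq> []"
      using equal_blocks[OF assms w] .
    obtain \<phi> p' q' where \<phi>: "\<And>n. \<phi> n \<in> lists X - {[]}"
      "u = p' @ concat (map \<phi> (zimin m)) @ q'"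
      using N[of u] eq w by auto
    \<comment> \<open>The end of the first block, the gap and the start of the second block;
      \<open>r\<close> makes it nonempty. The update keeps the image of \<open>zimin m\<close>, in
      which \<open>m\<close> does not occur.\<close>
    define \<psi> where "\<psi> = \<phi>(m := q' @ r @ p')"
    have "map \<psi> (zimin m) = map \<phi> (zimin m)" and "\<psi> m = q' @ r @ p'"
      by (simp_all add: \<psi>_def set_zimin)
    then have "concat (map \<psi> (zimin (Suc m))) =
        concat (map \<phi> (zimin m)) @ (q' @ r @ p') @ concat (map \<phi> (zimin m))"
      by (simp only: zimin.simps map_append list.map concat_append concat.simps)
    then have "w = (p @ p') @ concat (map \<psi> (zimin (Suc m))) @ (q' @ q)"
      unfolding eq(1) \<phi>(2) by simp
    moreover have "\<psi> n \<in> lists X - {[]}" for n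
      using \<phi>(1)[of n] eq(3) w(1) unfolding eq(1) \<phi>(2) by (auto simp: \<psi>_def)
    ultimately show ?thesis by blast
  qed
  then show ?case by blast
qed


section \<open>A Zimin identity of finite J-trivial monoids\<close>

text \<open>The last two assumptions say that Green's relations R and L are trivial. In a finite
  monoid this amounts to J-triviality.\<close>

locale finite_J_trivial_monoid =
  fixes M :: "'a set" and mult :: "'a \<Rightarrow> 'a \<Rightarrow> 'a" (infixl "\<star>" 70) and e :: 'a
  assumes fin: "finite M"
    and unit_closed: "e \<in> M"
    and closed: "x \<in> M \<Longrightarrow> y \<in> M \<Longrightarrow> x \<star> y \<in> M"
    and assoc: "x \<in> M \<Longrightarrow> y \<in> M \<Longrightarrow> z \<in> M \<Longrightarrow> (x \<star> y) \<star> z = x \<star> (y \<star> z)"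
    and unit_left: "x \<in> M \<Longrightarrow> e \<star> x = x"
    and unit_right: "x \<in> M \<Longrightarrow> x \<star> e = x"
    and R_trivial: "y \<in> M \<Longrightarrow> b \<in> M \<Longrightarrow> c \<in> M \<Longrightarrow> y \<star> (b \<star> c) = y \<Longrightarrow> y \<star> b = y"
    and L_trivial: "y \<in> M \<Longrightarrow> b \<in> M \<Longrightarrow> c \<in> M \<Longrightarrow> c \<star> (b \<star> y) = y \<Longrightarrow> b \<star> y = y"
begin

definition word_val :: "(nat \<Rightarrow> 'a) \<Rightarrow> nat list \<Rightarrow> 'a" where
  "word_val v w = foldr (\<lambda>n. (\<star>) (v n)) w e"

lemma word_val_simps [simp]:
  "word_val v [] = e" "word_val v (n # w) = v n \<star> word_val v w"
  by (simp_all add: word_val_def)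

lemma word_val_closed: "range v \<subseteq> M \<Longrightarrow> word_val v w \<in> M"
  by (induction w) (auto intro: unit_closed closed)

lemma word_val_append:
  "range v \<subseteq> M \<Longrightarrow> word_val v (w @ w') = word_val v w \<star> word_val v w'"
  by (induction w) (auto simp: unit_left assoc word_val_closed range_subsetD)

text \<open>The first letter is deleted inside a prefix \<open>zimin i @ i # zimin i\<close>. For
  suitable \<open>i\<close> its value is \<open>z\<close>, and it stays \<open>z\<close> when the
  first \<open>zimin i\<close> loses its first letter.\<close>

lemma word_val_zimin_tl:
  assumes v: "range v \<subseteq> M"
  shows "word_val v (zimin (Suc (card M))) = word_val v (tl (zimin (Suc (card M))))"
proof -
  \<comment> \<open>\<open>zimin 0\<close> has no first letter, so the indices are shifted by one.
    There are still \<open>card M + 1\<close> values.\<close>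
  let ?z = "\<lambda>i. word_val v (zimin (Suc i))"
  note [simp] = word_val_closed[OF v] range_subsetD[OF v]
  have "card (?z ` {..card M}) \<le> card M"
    by (intro card_mono fin) auto
  then have "\<not> inj_on ?z {..card M}"
    by (intro pigeonhole) simp
  then obtain i0 j0 where "i0 < j0" "j0 \<le> card M" "?z i0 = ?z j0"
    by (auto simp: inj_on_def) (metis linorder_neqE_nat)
  then obtain i j where ij: "0 < i" "i < j" "j \<le> Suc (card M)"
    "word_val v (zimin i) = word_val v (zimin j)"
    by (metis Suc_less_eq Suc_le_mono zero_less_Suc)
  \<comment> \<open>As \<open>i < j\<close>, \<open>zimin (Suc i)\<close> is a prefix of
    \<open>zimin j\<close>, and likewise of the long word below.\<close>
  obtain s where s: "zimin j = zimin i @ i # zimin i @ s"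
    using zimin_prefix[of "Suc i" j] ij by auto
  obtain s' where s': "zimin (Suc (card M)) = zimin i @ i # zimin i @ s'"
    using zimin_prefix[of "Suc i" "Suc (card M)"] ij by auto
  obtain a t where at: "zimin i = a # t"
    using length_zimin_ge[of i] ij(1) by (cases "zimin i") auto
  define z where "z = word_val v (zimin i)"
  have zM [simp]: "z \<in> M" by (simp add: z_def)
  have z: "z \<star> (v i \<star> (z \<star> word_val v s)) = z"
    using ij(4) unfolding s by (simp add: z_def word_val_append[OF v])
  \<comment> \<open>\<open>R_trivial\<close> is applied twice: first to make \<open>z\<close> absorb
    \<open>v i\<close> on its right, then, with that letter gone, to make \<open>z\<close>
    idempotent.\<close>
  have zx: "z \<star> v i = z"
    by (rule R_trivial[OF _ _ _ z]) (simp_all add: closed)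
  have "z \<star> (z \<star> word_val v s) = z"
    using z zx by (metis assoc closed word_val_closed[OF v] range_subsetD[OF v] zM)
  then have zz: "z \<star> z = z"
    by (rule R_trivial[rotated 3]) simp_all
  \<comment> \<open>Idempotence carries the absorption to the left side, in the form that
    \<open>L_trivial\<close> takes.\<close>
  have "z \<star> (v i \<star> z) = z"
    using zx zz by (simp flip: assoc)
  then have xz: "v i \<star> z = z"
    by (rule L_trivial[rotated 3]) simp_all
  \<comment> \<open>Splitting \<open>z \<star> z = z\<close> after the first letter shows that the
    tail \<open>t\<close> alone already fixes \<open>z\<close>.\<close>
  have "v a \<star> (word_val v t \<star> z) = z"
    using zz unfolding z_def at by (simp add: assoc closed)
  then have tz: "word_val v t \<star> z = z"
    by (rule L_trivial[rotated 3]) simp_all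
  have "word_val v (zimin i @ i # zimin i @ s') = z \<star> (v i \<star> z) \<star> word_val v s'"
    by (simp add: word_val_append[OF v] assoc closed flip: z_def)
  also have "\<dots> = word_val v t \<star> (v i \<star> z) \<star> word_val v s'"
    by (simp add: xz zz tz)
  also have "\<dots> = word_val v (tl (zimin i @ i # zimin i @ s'))"
    using z_def by (simp add: word_val_append[OF v] assoc closed at)
  finally show ?thesis
    unfolding s' .
qed

end

text \<open>If \<open>y b c = y\<close>, monotonicity and the greatest element \<open>e\<close> give
  \<open>y = y b c \<le> y b \<le> y\<close>. The relation \<open>le\<close> is a parameter so that
  it can also be a reversed order.\<close>

lemma ordered_finite_J_trivial_monoid:
  fixes le :: "'a \<Rightarrow> 'a \<Rightarrow> bool"
  assumes "finite M" and "e \<in> M"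
    and "\<And>x y. x \<in> M \<Longrightarrow> y \<in> M \<Longrightarrow> f x y \<in> M"
    and "\<And>x y z. x \<in> M \<Longrightarrow> y \<in> M \<Longrightarrow> z \<in> M \<Longrightarrow> f (f x y) z = f x (f y z)"
    and "\<And>x. x \<in> M \<Longrightarrow> f e x = x" and "\<And>x. x \<in> M \<Longrightarrow> f x e = x"
    and antisym: "\<And>x y. x \<in> M \<Longrightarrow> y \<in> M \<Longrightarrow> le x y \<Longrightarrow> le y x \<Longrightarrow> x = y"
    and mono: "\<And>x y z. x \<in> M \<Longrightarrow> y \<in> M \<Longrightarrow> z \<in> M \<Longrightarrow> le x y \<Longrightarrow> le (f z x) (f z y)"
      "\<And>x y z. x \<in> M \<Longrightarrow> y \<in> M \<Longrightarrow> z \<in> M \<Longrightarrow> le x y \<Longrightarrow> le (f x z) (f y z)"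
    and greatest: "\<And>x. x \<in> M \<Longrightarrow> le x e"
  shows "finite_J_trivial_monoid M f e"
proof
  fix y b c assume M: "y \<in> M" "b \<in> M" "c \<in> M"
  show "f y b = y" if "f y (f b c) = y"
  proof (rule antisym)
    show "le (f y b) y" using mono(1)[of b e y] M assms by simp
    show "le y (f y b)" using mono(1)[of c e "f y b"] M assms that by simp
  qed (use M assms(2,3) in auto)
  show "f b y = y" if "f c (f b y) = y"
  proof (rule antisym)
    show "le (f b y) y" using mono(2)[of b e y] M assms by simp
    show "le y (f b y)" using mono(2)[of c e "f b y"] M assms that by simp
  qed (use M assms(2,3) in auto)
qed (rule assms(1-6); assumption)+


section \<open>Words as terms\<close>

text \<open>The signature has no constant, so the value at \<open>[]\<close> is a dummy; evaluation
  lemmas assume a nonempty word.\<close>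

fun word_trm :: "nat list \<Rightarrow> trm" where
  "word_trm [] = Var 0"
| "word_trm [n] = Var n"
| "word_trm (n # w) = Times (Var n) (word_trm w)"

text \<open>Members of the variety may lack an identity, so products are meaningful for nonempty
  lists only.\<close>

fun list_mul :: "'a alg \<Rightarrow> 'a list \<Rightarrow> 'a" where
  "list_mul A [] = undefined"
| "list_mul A [x] = x"
| "list_mul A (x # w) = x \<odot>\<^bsub>A\<^esub> list_mul A w"

lemma list_mul_Cons: "w \<noteq> [] \<Longrightarrow> list_mul A (x # w) = x \<odot>\<^bsub>A\<^esub> list_mul A w"
  by (cases w) auto

lemma eval_word_trm: "w \<noteq> [] \<Longrightarrow> eval A v (word_trm w) = list_mul A (map v w)"
  by (induction w rule: word_trm.induct) auto

section \<open>The ai-semiring axioms as finitely many identities\<close>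

definition semiring_idents :: "ident set" where
  "semiring_idents =
    {(Plus (Plus (Var 0) (Var 1)) (Var 2), Plus (Var 0) (Plus (Var 1) (Var 2))),
     (Plus (Var 0) (Var 1), Plus (Var 1) (Var 0)),
     (Plus (Var 0) (Var 0), Var 0),
     (Times (Times (Var 0) (Var 1)) (Var 2), Times (Var 0) (Times (Var 1) (Var 2))),
     (Times (Var 0) (Plus (Var 1) (Var 2)), Plus (Times (Var 0) (Var 1)) (Times (Var 0) (Var 2))),
     (Times (Plus (Var 0) (Var 1)) (Var 2), Plus (Times (Var 0) (Var 2)) (Times (Var 1) (Var 2)))}"

lemma Mod_semiring_idents: "Mod semiring_idents = {A. ai_semiring A}"
proof (intro set_eqI iffI)
  fix A :: "'a alg" assume A: "A \<in> Mod semiring_idents"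
  \<comment> \<open>The axioms use only the variables 0, 1 and 2. This valuation sends them to
    \<open>x\<close>, \<open>y\<close>, \<open>z\<close> and stays inside the carrier.\<close>
  have *: "eval A (case_nat x (case_nat y (\<lambda>_. z))) s = eval A (case_nat x (case_nat y (\<lambda>_. z))) t"
    if "x \<in> carr A" "y \<in> carr A" "z \<in> carr A" "(s, t) \<in> semiring_idents" for x y z s t
  proof -
    have "range (case_nat x (case_nat y (\<lambda>_. z))) \<subseteq> carr A"
      using that by (auto split: nat.split)
    then show ?thesis
      using A that(4) unfolding Mod_def satisfies_def by fastforce
  qed
  note ids = *[unfolded semiring_idents_def]
  have "(x \<oplus>\<^bsub>A\<^esub> y) \<oplus>\<^bsub>A\<^esub> z = x \<oplus>\<^bsub>A\<^esub> (y \<oplus>\<^bsub>A\<^esub> z)" "x \<oplus>\<^bsub>A\<^esub> y = y \<oplus>\<^bsub>A\<^esub> x" "x \<oplus>\<^bsub>A\<^esub> x = x"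
    "(x \<odot>\<^bsub>A\<^esub> y) \<odot>\<^bsub>A\<^esub> z = x \<odot>\<^bsub>A\<^esub> (y \<odot>\<^bsub>A\<^esub> z)"
    "x \<odot>\<^bsub>A\<^esub> (y \<oplus>\<^bsub>A\<^esub> z) = (x \<odot>\<^bsub>A\<^esub> y) \<oplus>\<^bsub>A\<^esub> (x \<odot>\<^bsub>A\<^esub> z)"
    "(x \<oplus>\<^bsub>A\<^esub> y) \<odot>\<^bsub>A\<^esub> z = (x \<odot>\<^bsub>A\<^esub> z) \<oplus>\<^bsub>A\<^esub> (y \<odot>\<^bsub>A\<^esub> z)"
    if "x \<in> carr A" "y \<in> carr A" "z \<in> carr A" for x y z
    using ids[OF that, of "Plus (Plus (Var 0) (Var 1)) (Var 2)"]
      ids[OF that, of "Plus (Var 0) (Var 1)"] ids[OF that, of "Plus (Var 0) (Var 0)"]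
      ids[OF that, of "Times (Times (Var 0) (Var 1)) (Var 2)"]
      ids[OF that, of "Times (Var 0) (Plus (Var 1) (Var 2))"]
      ids[OF that, of "Times (Plus (Var 0) (Var 1)) (Var 2)"]
    by (simp_all add: numeral_2_eq_2)
  then show "A \<in> {A. ai_semiring A}"
    using A unfolding ai_semiring_def Mod_def by simp
next
  fix A :: "'a alg" assume "A \<in> {A. ai_semiring A}"
  then show "A \<in> Mod semiring_idents"
    by (simp add: Mod_def semiring_idents_def satisfies_def ai_semiring_def range_subsetD)
qed

section \<open>Products of nonempty lists\<close>

lemma list_mul_closed:
  "algebra A \<Longrightarrow> w \<in> lists (carr A) \<Longrightarrow> w \<noteq> [] \<Longrightarrow> list_mul A w \<in> carr A"
  by (induction A w rule: list_mul.induct) (auto simp: algebra_def)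

lemma list_mul_append:
  assumes "ai_semiring A" "w \<in> lists (carr A)" "w' \<in> lists (carr A)" "w \<noteq> []" "w' \<noteq> []"
  shows "list_mul A (w @ w') = list_mul A w \<odot>\<^bsub>A\<^esub> list_mul A w'"
  using assms(4,2)
proof (induction w rule: list_nonempty_induct)
  case (single x)
  then show ?case using assms(5) by (simp add: list_mul_Cons)
next
  case (cons x w)
  have "list_mul A w \<in> carr A" "list_mul A w' \<in> carr A"
    using assms cons by (auto intro!: list_mul_closed simp: ai_semiring_def)
  then show ?case
    using assms(1) cons by (simp add: list_mul_Cons ai_semiring_def)
qed

text \<open>This lets an identity between words be applied to their images under nonerasing
  substitutions: each variable is assigned the product of its block.\<close>

lemma list_mul_concat:
  assumes "ai_semiring A" "\<And>n. \<phi> n \<in> lists (carr A) - {[]}" "w \<noteq> []"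
  shows "list_mul A (concat (map \<phi> w)) = list_mul A (map (\<lambda>n. list_mul A (\<phi> n)) w)"
  using assms(3)
proof (induction w rule: list_nonempty_induct)
  case (cons n w)
  have "concat (map \<phi> w) \<in> lists (carr A)" "concat (map \<phi> w) \<noteq> []"
    using assms(2) cons(1) by (auto simp: neq_Nil_conv) blast+
  then show ?case
    using assms(2)[of n] cons by (simp add: list_mul_append[OF assms(1)] list_mul_Cons)
qed simp


section \<open>Local finiteness\<close>

inductive_set sums :: "'a alg \<Rightarrow> 'a set \<Rightarrow> 'a set" for A P where
  base: "x \<in> P \<Longrightarrow> x \<in> sums A P"
| add: "x \<in> sums A P \<Longrightarrow> y \<in> sums A P \<Longrightarrow> x \<oplus>\<^bsub>A\<^esub> y \<in> sums A P"

lemma sums_closed: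
  assumes "algebra A" "P \<subseteq> carr A" "x \<in> sums A P" shows "x \<in> carr A"
  using assms(3) by induction (use assms(1,2) in \<open>auto simp: algebra_def\<close>)

text \<open>A finitely generated semilattice is finite: by commutativity and idempotence a new
  generator \<open>p\<close> need occur at most once in a sum, and then in front.\<close>

lemma finite_sums:
  assumes "ai_semiring A" "finite P" "P \<subseteq> carr A"
  shows "finite (sums A P)"
  using assms(2,3)
proof (induction P)
  case empty
  have "x \<in> sums A {} \<Longrightarrow> False" for x
    by (induction rule: sums.induct) auto
  then have "sums A {} = {}" by blast
  then show ?case by simp
next
  case (insert p P)
  have A: "algebra A"
    and assoc: "\<And>x y z. \<lbrakk>x \<in> carr A; y \<in> carr A; z \<in> carr A\<rbrakk>
      \<Longrightarrow> (x \<oplus>\<^bsub>A\<^esub> y) \<oplus>\<^bsub>A\<^esub> z = x \<oplus>\<^bsub>A\<^esub> (y \<oplus>\<^bsub>A\<^esub> z)"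
    and comm: "\<And>x y. \<lbrakk>x \<in> carr A; y \<in> carr A\<rbrakk> \<Longrightarrow> x \<oplus>\<^bsub>A\<^esub> y = y \<oplus>\<^bsub>A\<^esub> x"
    and idem: "\<And>x. x \<in> carr A \<Longrightarrow> x \<oplus>\<^bsub>A\<^esub> x = x"
    using assms(1) unfolding ai_semiring_def by blast+
  have closed: "x \<oplus>\<^bsub>A\<^esub> y \<in> carr A" if "x \<in> carr A" "y \<in> carr A" for x y
    using A that by (simp add: algebra_def)
  have p: "p \<in> carr A" using insert by simp
  have C: "x \<in> carr A" if "x \<in> sums A P" for x
    using sums_closed[OF A _ that] insert by simp
  have left: "x \<oplus>\<^bsub>A\<^esub> (y \<oplus>\<^bsub>A\<^esub> z) = y \<oplus>\<^bsub>A\<^esub> (x \<oplus>\<^bsub>A\<^esub> z)"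
    if "x \<in> carr A" "y \<in> carr A" "z \<in> carr A" for x y z
    using that by (metis assoc comm)
  have lidem: "x \<oplus>\<^bsub>A\<^esub> (x \<oplus>\<^bsub>A\<^esub> z) = x \<oplus>\<^bsub>A\<^esub> z"
    if "x \<in> carr A" "z \<in> carr A" for x z
    using that by (metis assoc idem)
  have "x \<in> {p} \<union> sums A P \<union> (\<lambda>y. p \<oplus>\<^bsub>A\<^esub> y) ` sums A P"
    if "x \<in> sums A (insert p P)" for x
    using that
  proof induction
    case (base x)
    then show ?case by (auto intro: sums.base)
  next
    case (add x y)
    have xC: "x \<in> carr A" and yC: "y \<in> carr A"
      using add.IH C p closed by auto
    from add.IH(1) consider "x = p" | "x \<in> sums A P" | x' where "x = p \<oplus>\<^bsub>A\<^esub> x'" "x' \<in> sums A P"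
      by auto
    then show ?case
    proof cases
      case 1
      with add.IH(2) show ?thesis
        using p C idem lidem by auto
    next
      case 2
      with add.IH(2) show ?thesis
        using p C comm[of x p] left[of x p] by (auto intro: sums.add)
    next
      case 3
      with add.IH(2) show ?thesis
        using p C comm[OF xC p] left[OF xC p] lidem[OF p] closed[OF C C] assoc[OF p]
        by (auto intro: sums.add)
    qed
  qed
  then have "sums A (insert p P) \<subseteq> {p} \<union> sums A P \<union> (\<lambda>y. p \<oplus>\<^bsub>A\<^esub> y) ` sums A P"
    by blast
  then show ?case
    by (rule finite_subset) (use insert in auto)
qed

text \<open>Distributivity turns a product of sums into a sum of products, first in the right factor
  and then in the left one.\<close>

lemma sums_mul:
  assumes "ai_semiring A" "P \<subseteq> carr A"
    and mul: "\<And>x y. x \<in> P \<Longrightarrow> y \<in> P \<Longrightarrow> x \<odot>\<^bsub>A\<^esub> y \<in> P"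
    and x: "x \<in> sums A P" and y: "y \<in> sums A P"
  shows "x \<odot>\<^bsub>A\<^esub> y \<in> sums A P"
proof -
  have A: "algebra A" using assms(1) by (simp add: ai_semiring_def)
  note C = sums_closed[OF A assms(2)]
  have P: "p \<odot>\<^bsub>A\<^esub> y \<in> sums A P" if "p \<in> P" for p
    using y
  proof induction
    case (base y)
    then show ?case using mul that by (intro sums.base)
  next
    case (add y z)
    have "p \<odot>\<^bsub>A\<^esub> (y \<oplus>\<^bsub>A\<^esub> z) = (p \<odot>\<^bsub>A\<^esub> y) \<oplus>\<^bsub>A\<^esub> (p \<odot>\<^bsub>A\<^esub> z)"
      using assms(1,2) that C add.hyps unfolding ai_semiring_def by blast
    then show ?case using add.IH by (simp add: sums.add)
  qed
  show ?thesis
    using x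
  proof induction
    case (base x)
    then show ?case by (rule P)
  next
    case (add x z)
    have "(x \<oplus>\<^bsub>A\<^esub> z) \<odot>\<^bsub>A\<^esub> y = (x \<odot>\<^bsub>A\<^esub> y) \<oplus>\<^bsub>A\<^esub> (z \<odot>\<^bsub>A\<^esub> y)"
      using assms(1) y C add.hyps unfolding ai_semiring_def by blast
    then show ?case using add.IH by (simp add: sums.add)
  qed
qed

text \<open>The right word is one letter shorter. For \<open>m \<ge> 2\<close> it is nonempty, so
  neither side is the dummy term.\<close>

definition zimin_ident :: "nat \<Rightarrow> ident" where
  "zimin_ident m = (word_trm (zimin m), word_trm (tl (zimin m)))"

lemma tl_zimin_nonempty: "2 \<le> m \<Longrightarrow> tl (zimin m) \<noteq> []"
  using length_zimin_ge[of m] by (cases "zimin m") auto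

text \<open>A long word contains an image of \<open>zimin m\<close>. The identity deletes the image
  of its first letter without changing the product, and this repeats until the length is below
  \<open>N\<close>.\<close>

lemma short_representative:
  assumes A: "ai_semiring A" and zid: "satisfies A (zimin_ident m)" and m: "2 \<le> m"
    and X: "X \<subseteq> carr A"
    and N: "\<And>w. w \<in> lists X \<Longrightarrow> N \<le> length w \<Longrightarrow>
      \<exists>\<phi> p q. (\<forall>n. \<phi> n \<in> lists X - {[]}) \<and> w = p @ concat (map \<phi> (zimin m)) @ q"
    and w: "w \<in> lists X" "w \<noteq> []"
  shows "\<exists>u\<in>lists X. u \<noteq> [] \<and> length u \<le> N \<and> list_mul A u = list_mul A w"
  using w
proof (induction w rule: length_induct)
  case (1 w)
  show ?case
  proof (cases "N \<le> length w")
    case True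
    then obtain \<phi> p q where \<phi>: "\<And>n. \<phi> n \<in> lists X - {[]}"
      and w: "w = p @ concat (map \<phi> (zimin m)) @ q"
      using N 1 by metis
    have \<phi>A: "\<phi> n \<in> lists (carr A) - {[]}" for n
      using \<phi>[of n] X by auto
    obtain a t where at: "zimin m = a # t" "t \<noteq> []"
      using tl_zimin_nonempty[OF m] by (cases "zimin m") auto
    define c where "c = concat (map \<phi> (zimin m))"
    define d where "d = concat (map \<phi> t)"
    have ne: "c \<noteq> []" "d \<noteq> []"
      using \<phi> at by (auto simp: c_def d_def neq_Nil_conv)
    have pq: "p \<in> lists X" "q \<in> lists X"
      using 1 w by auto
    have cd: "c \<in> lists X" "d \<in> lists X"
      using \<phi> unfolding c_def d_def by (fastforce simp: in_lists_conv_set)+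
    let ?v = "\<lambda>n. list_mul A (\<phi> n)"
    have "range ?v \<subseteq> carr A"
      using \<phi>A A by (auto simp: ai_semiring_def intro!: list_mul_closed)
    then have "eval A ?v (word_trm (zimin m)) = eval A ?v (word_trm t)"
      using zid at by (simp add: satisfies_def zimin_ident_def)
    then have "list_mul A (map ?v (zimin m)) = list_mul A (map ?v t)"
      using at(2) by (simp add: eval_word_trm at(1) del: list.map)
    then have "list_mul A c = list_mul A d"
      unfolding c_def d_def using at
      by (metis list.distinct(1) list_mul_concat[of A \<phi>, OF A \<phi>A])
    \<comment> \<open>Either context \<open>p\<close> or \<open>q\<close> may be empty and then has
      no product, so replacing \<open>c\<close> by \<open>d\<close> is checked case by case.\<close>
    moreover have "list_mul A (u @ q) = list_mul A u \<odot>\<^bsub>A\<^esub> list_mul A q"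
      if "u \<in> lists X" "u \<noteq> []" "q \<noteq> []" for u
      using that pq X by (intro list_mul_append A) auto
    moreover have "list_mul A (p @ u) = list_mul A p \<odot>\<^bsub>A\<^esub> list_mul A u"
      if "u \<in> lists X" "u \<noteq> []" "p \<noteq> []" for u
      using that pq X by (intro list_mul_append A) auto
    ultimately have "list_mul A (p @ c @ q) = list_mul A (p @ d @ q)"
      using cd ne pq by (cases "p = []"; cases "q = []") auto
    \<comment> \<open>The decrease is strict because \<open>\<phi> a\<close> is nonempty.\<close>
    moreover have "length (p @ d @ q) < length w"
      using \<phi>[of a] by (simp add: w at d_def)
    moreover have "p @ d @ q \<in> lists X" "p @ d @ q \<noteq> []"
      using pq cd ne by auto
    ultimately show ?thesis
      using 1(1) unfolding w c_def by metis
  next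
    case False
    then show ?thesis using 1 by (intro bexI[of _ w]) auto
  qed
qed

text \<open>The subsemigroup \<open>P\<close> generated multiplicatively by \<open>X\<close> is
  finite, since short words represent all its elements. Its sums form a finite set closed under both
  operations, which therefore exhausts the carrier.\<close>

lemma locally_finite_zimin:
  assumes "2 \<le> m"
  shows "locally_finite (Mod (insert (zimin_ident m) semiring_idents))"
  unfolding locally_finite_def
proof (intro ballI impI)
  fix A :: "nat alg"
  assume "A \<in> Mod (insert (zimin_ident m) semiring_idents)" and fg: "finitely_generated A"
  then have A: "A \<in> Mod semiring_idents" and zid: "satisfies A (zimin_ident m)"
    by (simp_all add: Mod_def)
  have A: "ai_semiring A" using A unfolding Mod_semiring_idents by simp
  obtain X where X: "finite X" "X \<subseteq> carr A" "generated A X = carr A"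
    using fg unfolding finitely_generated_def by blast
  obtain N where N: "\<And>w. w \<in> lists X \<Longrightarrow> N \<le> length w \<Longrightarrow>
      \<exists>\<phi> p q. (\<forall>n. \<phi> n \<in> lists X - {[]}) \<and> w = p @ concat (map \<phi> (zimin m)) @ q"
    using zimin_unavoidable[OF X(1), of m] by blast
  define P where "P = list_mul A ` (lists X - {[]})"
  have PC: "P \<subseteq> carr A"
    using A X(2) unfolding P_def by (auto simp: ai_semiring_def intro!: list_mul_closed)
  have "P \<subseteq> list_mul A ` {u. set u \<subseteq> X \<and> length u \<le> N}"
  proof
    fix x assume "x \<in> P"
    then obtain w where "w \<in> lists X" "w \<noteq> []" "x = list_mul A w"
      unfolding P_def by blast
    moreover from this obtain u where "u \<in> lists X" "length u \<le> N" "list_mul A u = list_mul A w"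
      using short_representative[OF A zid assms X(2) N] by blast
    ultimately show "x \<in> list_mul A ` {u. set u \<subseteq> X \<and> length u \<le> N}"
      by (intro image_eqI[of _ _ u]) auto
  qed
  then have "finite P"
    by (rule finite_subset) (use finite_lists_length_le[OF X(1)] in blast)
  have Pmul: "x \<odot>\<^bsub>A\<^esub> y \<in> P" if "x \<in> P" "y \<in> P" for x y
  proof -
    obtain u w where uw: "u \<in> lists X - {[]}" "w \<in> lists X - {[]}" "x = list_mul A u" "y = list_mul A w"
      using \<open>x \<in> P\<close> \<open>y \<in> P\<close> unfolding P_def by blast
    then have "x \<odot>\<^bsub>A\<^esub> y = list_mul A (u @ w)"
      using X(2) by (subst list_mul_append[OF A]) auto
    then show ?thesis
      unfolding P_def using uw by (intro image_eqI[of _ _ "u @ w"]) auto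
  qed
  have "x \<in> sums A P" if "x \<in> generated A X" for x
    using that
  proof induction
    case (base x)
    then show ?case
      unfolding P_def by (intro sums.base image_eqI[of _ _ "[x]"]) auto
  qed (auto intro: sums.add sums_mul[OF A PC Pmul])
  then have "carr A \<subseteq> sums A P"
    using X(3) by blast
  then show "finite (carr A)"
    using finite_sums[OF A \<open>finite P\<close> PC] by (rule finite_subset)
qed


section \<open>Semirings with an extremal identity\<close>

lemma extremal_identity_J_trivial:
  assumes S: "ai_semiring S" and "finite (carr S)" and "mult_identity S e"
    and ext: "(\<forall>x\<in>carr S. x \<sqsubseteq>\<^bsub>S\<^esub> e) \<or> (\<forall>x\<in>carr S. e \<sqsubseteq>\<^bsub>S\<^esub> x)"
  shows "finite_J_trivial_monoid (carr S) (mul S) e"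
proof -
  have antisym: "x = y" if "x \<in> carr S" "y \<in> carr S" "x \<sqsubseteq>\<^bsub>S\<^esub> y" "y \<sqsubseteq>\<^bsub>S\<^esub> x" for x y
    using S that unfolding ai_semiring_def ai_le_def by metis
  have mono: "z \<odot>\<^bsub>S\<^esub> x \<sqsubseteq>\<^bsub>S\<^esub> z \<odot>\<^bsub>S\<^esub> y" "x \<odot>\<^bsub>S\<^esub> z \<sqsubseteq>\<^bsub>S\<^esub> y \<odot>\<^bsub>S\<^esub> z"
    if "x \<in> carr S" "y \<in> carr S" "z \<in> carr S" "x \<sqsubseteq>\<^bsub>S\<^esub> y" for x y z
    using S that unfolding ai_semiring_def ai_le_def by metis+
  have basic: "e \<in> carr S"
    "\<And>x y. x \<in> carr S \<Longrightarrow> y \<in> carr S \<Longrightarrow> x \<odot>\<^bsub>S\<^esub> y \<in> carr S"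
    "\<And>x y z. x \<in> carr S \<Longrightarrow> y \<in> carr S \<Longrightarrow> z \<in> carr S \<Longrightarrow> (x \<odot>\<^bsub>S\<^esub> y) \<odot>\<^bsub>S\<^esub> z = x \<odot>\<^bsub>S\<^esub> (y \<odot>\<^bsub>S\<^esub> z)"
    "\<And>x. x \<in> carr S \<Longrightarrow> e \<odot>\<^bsub>S\<^esub> x = x" "\<And>x. x \<in> carr S \<Longrightarrow> x \<odot>\<^bsub>S\<^esub> e = x"
    using S assms(3) unfolding ai_semiring_def algebra_def mult_identity_def by auto
  from ext show ?thesis
  proof
    assume "\<forall>x\<in>carr S. x \<sqsubseteq>\<^bsub>S\<^esub> e"
    then show ?thesis
      by (intro ordered_finite_J_trivial_monoid[where le = "ai_le S"] assms(2) basic)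
        (use antisym mono in auto)
  next
    assume "\<forall>x\<in>carr S. e \<sqsubseteq>\<^bsub>S\<^esub> x"
    then show ?thesis
      \<comment> \<open>In the reversed order a least identity is the greatest element, and
        multiplication is still monotone.\<close>
      by (intro ordered_finite_J_trivial_monoid[where le = "\<lambda>x y. y \<sqsubseteq>\<^bsub>S\<^esub> x"] assms(2) basic)
        (use antisym mono in auto)
  qed
qed

lemma satisfies_zimin_ident:
  assumes "finite_J_trivial_monoid (carr S) (mul S) e"
  shows "satisfies S (zimin_ident (Suc (card (carr S))))"
proof -
  interpret finite_J_trivial_monoid "carr S" "mul S" e by fact
  have ev: "eval S v (word_trm w) = word_val v w" if "range v \<subseteq> carr S" "w \<noteq> []" for v w
    using that(2)
    by (induction w rule: word_trm.induct) (use that(1) in \<open>auto simp: unit_right range_subsetD\<close>)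
  \<comment> \<open>A nonempty carrier gives index at least 2, so both words are nonempty and their
    terms evaluate to \<open>word_val\<close>.\<close>
  have "0 < card (carr S)"
    using fin unit_closed card_gt_0_iff by blast
  then have m: "2 \<le> Suc (card (carr S))" by simp
  then have "zimin (Suc (card (carr S))) \<noteq> []"
    using tl_zimin_nonempty by fastforce
  then show ?thesis
    unfolding satisfies_def zimin_ident_def
    using ev tl_zimin_nonempty[OF m] word_val_zimin_tl by (simp del: zimin.simps)
qed

lemma extremal_identity_not_INFB:
  assumes S: "ai_semiring S" and "finite (carr S)" and "mult_identity S e"
    and "(\<forall>x\<in>carr S. x \<sqsubseteq>\<^bsub>S\<^esub> e) \<or> (\<forall>x\<in>carr S. e \<sqsubseteq>\<^bsub>S\<^esub> x)"
  shows "\<not> INFB S"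
proof -
  let ?E = "insert (zimin_ident (Suc (card (carr S)))) semiring_idents"
  have alg: "algebra S" using S by (simp add: ai_semiring_def)
  have "S \<in> Mod semiring_idents"
    using S by (simp add: Mod_semiring_idents)
  then have "S \<in> Mod ?E"
    using satisfies_zimin_ident[OF extremal_identity_J_trivial[OF assms]] by (simp add: Mod_def)
  then have "variety_generated S \<subseteq> Mod ?E"
    by (rule variety_generated_least(3)[OF alg])
  moreover have "0 < card (carr S)"
    using assms(2,3) by (auto simp: card_gt_0_iff mult_identity_def)
  then have "locally_finite (Mod ?E)"
    by (intro locally_finite_zimin) simp
  moreover have "finite ?E" by (simp add: semiring_idents_def)
  ultimately show ?thesis
    unfolding INFB_def inherently_nonfinitely_based_def variety_def finitely_based_def by blast
qed

theorem proposition2p18: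
  fixes S :: "'a alg" and e :: 'a
  assumes "ai_semiring S" and "finite (carr S)" and "mult_identity S e"
  shows "((\<forall>x\<in>carr S. x \<sqsubseteq>\<^bsub>S\<^esub> e) \<or> (\<forall>x\<in>carr S. e \<sqsubseteq>\<^bsub>S\<^esub> x) \<longrightarrow> \<not> INFB S) \<and>
    (INFB S \<longrightarrow> (\<exists>a\<in>carr S. \<exists>b\<in>carr S. \<not> a \<sqsubseteq>\<^bsub>S\<^esub> e \<and> \<not> e \<sqsubseteq>\<^bsub>S\<^esub> b))"
  \<comment> \<open>The second claim is the contrapositive: \<open>a\<close> witnesses that
    \<open>e\<close> is not greatest, \<open>b\<close> that it is not least.\<close>
  using extremal_identity_not_INFB[OF assms] by blast

end
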